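(* Let $A\in\mathbb{R}^{m\times n}$ be a matrix of full column rank $n$ whose rows $\mathbf{a}_1^T,\dots,\mathbf{a}_m^T$ satisfy $\|\mathbf{a}_i\|=1$ for all $i$, and let $\mathbf{b}\in\mathbb{R}^m$. Let $\mathbf{x}\in\mathbb{R}^n$ be arbitrary and set $\mathbf{e}=A\mathbf{x}-\mathbf{b}$. Let $(\mathbf{x}_k)_{k\ge0}$ be iterates of Motzkin's method with arbitrary $\mathbf{x}_0\in\mathbb{R}^n$. Then for every $k\ge 0$, either (i) holds, or both (ii) and (iii) hold, where (i) $\|\mathbf{x}_{k+1}-\mathbf{x}\|^2\le\|\mathbf{x}_k-\mathbf{x}\|^2-\frac12\|A\mathbf{x}_k-\mathbf{b}\|_\infty^2$; (ii) $\|\mathbf{x}_k-\mathbf{x}\|^2\le 25\,m\,\sigma_{\min}^{-2}(A)\,\|\mathbf{e}\|_\infty^2$; (iii) $\|\mathbf{x}_{k+1}-\mathbf{x}\|^2\le\left(25\,m\,\sigma_{\min}^{-2}(A)+8\right)\|\mathbf{e}\|_\infty^2$. In addition, suppose the method is run for $K$ iterations with the stopping criterion $\|A\mathbf{x}_K-\mathbf{b}\|_\infty\le4\|\mathbf{e}\|_\infty$, i.e. $\|A\mathbf{x}_k-\mathbf{b}\|_\infty>4\|\mathbf{e}\|_\infty$ for all $0\le k<K$ and $\|A\mathbf{x}_K-\mathbf{b}\|_\infty\le4\|\mathbf{e}\|_\infty$. Put $\gamma_k:=\dfrac{\|A\mathbf{x}_k-A\mathbf{x}\|^2}{\|A\mathbf{x}_k-A\mathbf{x}\|_\infty^2}$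 for $0\le k<K$. Then $$\|\mathbf{x}_K-\mathbf{x}\|^2\le\prod_{k=0}^{K-1}\left(1-\frac{\sigma_{\min}^2(A)}{4\gamma_k}\right)\|\mathbf{x}_0-\mathbf{x}\|^2+2m\,\sigma_{\min}^{-2}(A)\|\mathbf{e}\|_\infty^2$$ $$\le\left(1-\frac{\sigma_{\min}^2(A)}{4m}\right)^K\|\mathbf{x}_0-\mathbf{x}\|^2+2m\,\sigma_{\min}^{-2}(A)\|\mathbf{e}\|_\infty^2,$$ and the final error satisfies (ii) with $k=K$, i.e. $\|\mathbf{x}_K-\mathbf{x}\|^2\le 25\,m\,\sigma_{\min}^{-2}(A)\,\|\mathbf{e}\|_\infty^2$.
   Context: $\|\cdot\|$ is the Euclidean norm, $\|\cdot\|_\infty$ the maximum norm, and $\sigma_{\min}(A)$ the smallest singular value of $A$ (positive since $A$ has full column rank $n$); $\sigma_{\min}^{-2}(A)=1/\sigma_{\min}(A)^2$. An empty product equals $1$. Motzkin's method for the system $A\mathbf{x}=\mathbf{b}$ (which may be inconsistent), with $A$ having unit-norm rows, starts from an arbitrary $\mathbf{x}_0\in\mathbb{R}^n$ and computes $$\mathbf{x}_{k+1}=\mathbf{x}_k+(b_{i_{k+1}}-\mathbf{a}_{i_{k+1}}^T\mathbf{x}_k)\,\mathbf{a}_{i_{k+1}},\qquad i_{k+1}\in\operatorname{argmax}_{i\in\{1,\dots,m\}}(\mathbf{a}_i^T\mathbf{x}_k-b_i)^2,$$ with ties in the argmax broken arbitrarily. The vector $\mathbf{x}$ is a "desired solution",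 which is allowed to be any point of $\mathbb{R}^n$ (for example the least-squares solution). *)

theory Defs
  imports "HOL-Analysis.Analysis"
begin

(* The eigenvalues of the positive semidefinite matrix transpose A ** A are nonnegative,
   so sqrt is only applied to nonnegative numbers.  For a matrix with fewer rows than
   columns this set also contains 0, which the min(m,n) convention would leave out;
   the two conventions agree for matrices of full column rank. *)
definition singular_values :: "real^'n^'m \<Rightarrow> real set" where
  "singular_values A =
     {sqrt l | l. \<exists>v. v \<noteq> 0 \<and> (transpose A ** A) *v v = l *\<^sub>R v}"

definition sigma_min :: "real^'n^'m \<Rightarrow> real" where
  "sigma_min A = Min (singular_values A)"

(* Ties in the argmax may be broken differently at every step. *)
definition motzkin_iterates ::
    "real^'n^'m \<Rightarrow> real^'m \<Rightarrow> (nat \<Rightarrow> real^'n) \<Rightarrow> bool" where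
  "motzkin_iterates A b X \<longleftrightarrow>
     (\<forall>k. \<exists>i. is_arg_max (\<lambda>j. (row j A \<bullet> X k - b $ j)\<^sup>2) (\<lambda>_. True) i \<and>
              X (Suc k) = X k + (b $ i - row i A \<bullet> X k) *\<^sub>R row i A)"

end

theory Submission
  imports Defs
begin

text \<open>
  If row i is selected at step k, then with d = x_k - x, r = A x_k - b and a_i . d = r_i - e_i
  the projection step gives |d'|^2 = |d|^2 - r_i^2 + 2 r_i e_i, where |r_i| is the maximum norm R
  of r. Writing E for the maximum norm of e, a large residual (R \<ge> 4E) makes the cross term at
  most R^2/2. A small one bounds the maximum norm of A d by R + E \<le> 5E, which controls d through
  the variational inequality sigma_min A * |d| \<le> |A d|. The linear rate follows from the same
  inequality, since R > 4E forces the maximum norm of A d below 5R/4.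
\<close>

section \<open>The smallest singular value through the spectrum of the Gram matrix\<close>

lemma inner_gram_matrix:
  fixes A :: "real^'n^'m"
  shows "((transpose A ** A) *v u) \<bullet> v = (A *v u) \<bullet> (A *v v)"
  by (metis dot_lmul_matrix matrix_vector_mul_assoc transpose_matrix_vector)

lemma gram_eigenvalue:
  fixes A :: "real^'n^'m"
  assumes "(transpose A ** A) *v v = l *\<^sub>R v"
  shows "(norm (A *v v))\<^sup>2 = l * (norm v)\<^sup>2"
  using inner_gram_matrix[of A v v] assms by (simp add: power2_norm_eq_inner)

text \<open>Symmetry makes eigenvectors for distinct eigenvalues orthogonal, so choosing one per
  eigenvalue gives an independent, hence finite, set. Finiteness is what gives the
  \<open>Min\<close> in \<open>sigma_min\<close> its meaning.\<close>

lemma finite_gram_eigenvalues: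
  fixes A :: "real^'n^'m"
  shows "finite {l. \<exists>v. v \<noteq> 0 \<and> (transpose A ** A) *v v = l *\<^sub>R v}" (is "finite ?L")
proof -
  have "\<forall>l\<in>?L. \<exists>v. v \<noteq> 0 \<and> (transpose A ** A) *v v = l *\<^sub>R v" by blast
  from bchoice[OF this]
  obtain f where f: "\<And>l. l \<in> ?L \<Longrightarrow> f l \<noteq> 0 \<and> (transpose A ** A) *v f l = l *\<^sub>R f l"
    by blast
  have orth: "f l \<bullet> f l' = 0" if "l \<in> ?L" "l' \<in> ?L" "l \<noteq> l'" for l l'
  proof -
    have "l * (f l \<bullet> f l') = l' * (f l \<bullet> f l')"
      using f[OF that(1)] f[OF that(2)] inner_gram_matrix[of A "f l" "f l'"]
        inner_gram_matrix[of A "f l'" "f l"] by (simp add: inner_commute)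
    with that(3) show ?thesis by simp
  qed
  have inj: "inj_on f ?L"
  proof (rule inj_onI, rule ccontr)
    fix l l' assume l: "l \<in> ?L" "l' \<in> ?L" "f l = f l'" "l \<noteq> l'"
    with orth[OF l(1,2,4)] f[OF l(1)] show False by simp
  qed
  have "pairwise orthogonal (f ` ?L)"
    unfolding pairwise_def orthogonal_def using orth by blast
  moreover have "0 \<notin> f ` ?L" using f by (metis (no_types, lifting) imageE)
  ultimately have "independent (f ` ?L)"
    by (rule pairwise_orthogonal_independent)
  then have "finite (f ` ?L)" by (rule independent_imp_finite)
  with inj show ?thesis by (rule finite_imageD[rotated])
qed

lemma finite_singular_values: "finite (singular_values A)"
proof -
  have "singular_values A = sqrt ` {l. \<exists>v. v \<noteq> 0 \<and> (transpose A ** A) *v v = l *\<^sub>R v}"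
    unfolding singular_values_def by auto
  then show ?thesis by (simp add: finite_gram_eigenvalues)
qed

text \<open>Moving from \<open>v\<close> along \<open>w = f v\<close> changes the form by a linear
  term with coefficient 2 |f v|^2 and a quadratic one. A nonzero linear term would make the form
  negative for small \<open>t\<close> of the right sign.\<close>

lemma psd_quadratic_form_zero:
  fixes f :: "'a::real_inner \<Rightarrow> 'a"
  assumes lin: "linear f" and sym: "\<And>u w. f u \<bullet> w = u \<bullet> f w"
    and pos: "\<And>u. f u \<bullet> u \<ge> 0" and zero: "f v \<bullet> v = 0"
  shows "f v = 0"
proof -
  define w where "w = f v"
  define c where "c = w \<bullet> w"
  define q where "q = f w \<bullet> w"
  have q: "q \<ge> 0" unfolding q_def by (rule pos)
  have quad: "2 * t * c + t\<^sup>2 * q \<ge> 0" for t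
  proof -
    have "f (v + t *\<^sub>R w) \<bullet> (v + t *\<^sub>R w) = 2 * t * c + t\<^sup>2 * q"
      using zero sym[of w v]
      by (simp add: linear_add[OF lin] linear_scale[OF lin] inner_add_left inner_add_right
          c_def q_def w_def power2_eq_square algebra_simps)
    with pos[of "v + t *\<^sub>R w"] show ?thesis by simp
  qed
  \<comment> \<open>The minimiser of the quadratic would be \<open>- c / q\<close>; the denominator
    \<open>q + 1\<close> also covers \<open>q = 0\<close>, and the value at \<open>t\<close> is
    still at most 0, with equality only for \<open>t = 0\<close>.\<close>
  define t where "t = - c / (q + 1)"
  have c: "c = - t * (q + 1)"
    using q by (simp add: t_def)
  have "2 * t * c + t\<^sup>2 * q = - (t\<^sup>2 * (q + 2))"
    unfolding c by (simp add: power2_eq_square algebra_simps)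
  with quad[of t] have "t\<^sup>2 * (q + 2) \<le> 0" by simp
  then have "t = 0"
    using q by (simp add: mult_le_0_iff)
  then have "c = 0" by (simp add: c)
  then show ?thesis unfolding c_def w_def by simp
qed

text \<open>The minimum over the unit sphere is attained, and a minimiser is an eigenvector because
  the form with matrix \<open>transpose A ** A - l I\<close> is positive semidefinite and vanishes there.\<close>
lemma least_gram_eigenvalue_exists:
  fixes A :: "real^'n^'m"
  obtains v l where "v \<noteq> 0" "(transpose A ** A) *v v = l *\<^sub>R v" "l \<ge> 0"
    "\<And>u. l * (norm u)\<^sup>2 \<le> (norm (A *v u))\<^sup>2"
proof -
  have ne: "sphere (0::real^'n) 1 \<noteq> {}" by simp
  have "continuous_on (sphere 0 1) (\<lambda>u. (norm (A *v u))\<^sup>2)"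
    by (intro continuous_intros)
  from continuous_attains_inf[OF compact_sphere ne this]
  obtain v where v: "norm v = 1"
    and min: "\<And>u. norm u = 1 \<Longrightarrow> (norm (A *v v))\<^sup>2 \<le> (norm (A *v u))\<^sup>2" by auto
  define l where "l = (norm (A *v v))\<^sup>2"
  have lower: "l * (norm u)\<^sup>2 \<le> (norm (A *v u))\<^sup>2" for u
  proof (cases "u = 0")
    case False
    have "l \<le> (norm (A *v ((1 / norm u) *\<^sub>R u)))\<^sup>2"
      unfolding l_def using False by (intro min) simp
    also have "\<dots> = (norm (A *v u))\<^sup>2 / (norm u)\<^sup>2"
      by (simp add: matrix_vector_mult_scaleR power_divide)
    finally show ?thesis using False by (simp add: field_simps)
  qed simp
  define f where "f u = (transpose A ** A) *v u - l *\<^sub>R u" for u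
  have inner: "f u \<bullet> w = (A *v u) \<bullet> (A *v w) - l * (u \<bullet> w)" for u w
    by (simp add: f_def inner_diff_left inner_gram_matrix)
  have "f v = 0"
  proof (rule psd_quadratic_form_zero[of f v])
    show "linear f" unfolding f_def[abs_def]
      by (intro linear_compose_sub matrix_vector_mul_linear linear_scaleR)
    show "f u \<bullet> w = u \<bullet> f w" for u w
      using inner[of u w] inner[of w u] by (simp add: inner_commute)
    show "f u \<bullet> u \<ge> 0" for u
      using lower[of u] by (simp add: inner power2_norm_eq_inner)
    show "f v \<bullet> v = 0"
      using v by (simp add: inner l_def flip: power2_norm_eq_inner)
  qed
  then show ?thesis
    using v lower by (intro that[of v l]) (auto simp: f_def l_def)
qed

text \<open>Testing the variational inequality on an arbitrary eigenvector shows that its constant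
  \<open>l\<close> is the least eigenvalue, so \<open>sigma_min A\<close> is
  \<open>sqrt l\<close>.\<close>

lemma sigma_min_bound:
  fixes A :: "real^'n^'m"
  shows "(sigma_min A)\<^sup>2 * (norm u)\<^sup>2 \<le> (norm (A *v u))\<^sup>2"
proof -
  obtain v l where v: "v \<noteq> 0" "(transpose A ** A) *v v = l *\<^sub>R v" "l \<ge> 0"
    and lower: "\<And>u. l * (norm u)\<^sup>2 \<le> (norm (A *v u))\<^sup>2"
    using least_gram_eigenvalue_exists[of A] by blast
  have "sigma_min A = sqrt l"
    unfolding sigma_min_def
  proof (rule Min_eqI[OF finite_singular_values])
    show "sqrt l \<in> singular_values A"
      using v unfolding singular_values_def by auto
  next
    fix s assume "s \<in> singular_values A"
    then obtain l' v' where s: "s = sqrt l'" "v' \<noteq> 0" "(transpose A ** A) *v v' = l' *\<^sub>R v'"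
      unfolding singular_values_def by auto
    have "l * (norm v')\<^sup>2 \<le> l' * (norm v')\<^sup>2"
      using lower[of v'] gram_eigenvalue[OF s(3)] by simp
    with s show "sqrt l \<le> s" by simp
  qed
  with v(3) lower show ?thesis by simp
qed

text \<open>The minimum belongs to some eigenvector \<open>v'\<close>, and |A v'|^2 = l' |v'|^2
  cannot vanish when \<open>A\<close> is injective.\<close>

lemma sigma_min_nonzero:
  fixes A :: "real^'n^'m"
  assumes "rank A = CARD('n)"
  shows "sigma_min A \<noteq> 0"
proof -
  have inj: "inj ((*v) A)"
    using assms full_rank_injective[of A] by simp
  \<comment> \<open>This eigenvector serves to show that \<open>singular_values A\<close> is
    nonempty, as \<open>Min_in\<close> requires.\<close>
  obtain v l where v: "v \<noteq> 0" "(transpose A ** A) *v v = l *\<^sub>R v"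
    using least_gram_eigenvalue_exists[of A] by blast
  have "sigma_min A \<in> singular_values A"
    unfolding sigma_min_def
    using v by (intro Min_in finite_singular_values) (auto simp: singular_values_def)
  then obtain l' v' where s: "sigma_min A = sqrt l'" "v' \<noteq> 0"
      "(transpose A ** A) *v v' = l' *\<^sub>R v'"
    unfolding singular_values_def by auto
  have "A *v v' \<noteq> 0"
    using inj s(2) by (metis injD matrix_vector_mult_0_right)
  with gram_eigenvalue[OF s(3)] have "l' \<noteq> 0" by auto
  with s(1) show ?thesis by simp
qed

section \<open>Comparisons between the maximum norm and the Euclidean norm\<close>

lemma infnorm_eq_component:
  fixes r :: "real^'m"
  assumes "\<And>j. (r $ j)\<^sup>2 \<le> (r $ i)\<^sup>2"
  shows "infnorm r = \<bar>r $ i\<bar>"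
proof (rule antisym)
  have "\<And>j. \<bar>r $ j\<bar> \<le> \<bar>r $ i\<bar>"
    using assms by (simp add: abs_le_square_iff)
  then show "infnorm r \<le> \<bar>r $ i\<bar>"
    unfolding infnorm_cart by (intro cSup_least) auto
qed (rule component_le_infnorm_cart)

text \<open>Cauchy-Schwarz against each unit row. It later keeps the contraction factor
  nonnegative.\<close>

lemma infnorm_mult_le_norm:
  fixes A :: "real^'n^'m"
  assumes "\<And>i. norm (row i A) = 1"
  shows "infnorm (A *v u) \<le> norm u"
proof -
  have "\<bar>(A *v u) $ i\<bar> \<le> norm u" for i
    using Cauchy_Schwarz_ineq2[of "row i A" u] assms
    by (simp add: matrix_vector_mul_component row_def)
  then show ?thesis
    unfolding infnorm_cart by (intro cSup_least) auto
qed

lemma norm_sq_le_infnorm_sq: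
  fixes u :: "real^'m"
  shows "(norm u)\<^sup>2 \<le> real CARD('m) * (infnorm u)\<^sup>2"
  using power_mono[OF norm_le_infnorm[of u], of 2]
  by (simp add: power_mult_distrib)

section \<open>Effect of one projection step on the error, for small and for large residuals\<close>

lemma motzkin_step:
  fixes A :: "real^'n^'m"
  assumes unit: "\<And>i. norm (row i A) = 1" and it: "motzkin_iterates A b X"
  shows "(norm (X (Suc k) - x))\<^sup>2 \<le> (norm (X k - x))\<^sup>2 - (infnorm (A *v X k - b))\<^sup>2
           + 2 * infnorm (A *v X k - b) * infnorm (A *v x - b)"
proof -
  define r where "r = A *v X k - b"
  define e where "e = A *v x - b"
  have row: "row i A \<bullet> u = (A *v u) $ i" for i u
    by (simp add: matrix_vector_mul_component row_def)
  obtain i where max: "is_arg_max (\<lambda>j. (row j A \<bullet> X k - b $ j)\<^sup>2) (\<lambda>_. True) i"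
    and step: "X (Suc k) = X k + (b $ i - row i A \<bullet> X k) *\<^sub>R row i A"
    using it unfolding motzkin_iterates_def by blast
  \<comment> \<open>The greedy choice of \<open>i\<close> enters here: the decrease
    \<open>(r $ i)\<^sup>2\<close> is the full squared maximum norm of the residual.\<close>
  have R: "infnorm r = \<bar>r $ i\<bar>"
    using max by (intro infnorm_eq_component) (auto simp: is_arg_max_linorder r_def row)
  have diff: "X (Suc k) - x = (X k - x) - (r $ i) *\<^sub>R row i A"
    unfolding step r_def by (simp add: row algebra_simps)
  have "(norm (d - t *\<^sub>R row i A))\<^sup>2 = (norm d)\<^sup>2 - 2 * t * (row i A \<bullet> d) + t\<^sup>2" for d t
    using unit[of i]
    by (simp add: power2_norm_eq_inner inner_diff_left inner_diff_right inner_commute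
        norm_eq_1 power2_eq_square[of t])
  then have "(norm (X (Suc k) - x))\<^sup>2
      = (norm (X k - x))\<^sup>2 - 2 * (r $ i) * (row i A \<bullet> (X k - x)) + (r $ i)\<^sup>2"
    unfolding diff .
  also have "row i A \<bullet> (X k - x) = r $ i - e $ i"
    by (simp add: row r_def e_def matrix_vector_mult_diff_distrib)
  also have "(norm (X k - x))\<^sup>2 - 2 * (r $ i) * (r $ i - e $ i) + (r $ i)\<^sup>2
      = (norm (X k - x))\<^sup>2 - (r $ i)\<^sup>2 + 2 * ((r $ i) * (e $ i))"
    by (simp add: power2_eq_square algebra_simps)
  also have "(r $ i) * (e $ i) \<le> \<bar>r $ i\<bar> * infnorm e"
  proof -
    have "(r $ i) * (e $ i) \<le> \<bar>r $ i\<bar> * \<bar>e $ i\<bar>" by (metis abs_ge_self abs_mult)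
    also have "\<dots> \<le> \<bar>r $ i\<bar> * infnorm e"
      by (intro mult_left_mono component_le_infnorm_cart) simp
    finally show ?thesis .
  qed
  also have "(r $ i)\<^sup>2 = (infnorm r)\<^sup>2" by (simp add: R)
  finally show ?thesis
    unfolding r_def[symmetric] e_def[symmetric] R by simp
qed

lemma infnorm_mult_diff_le:
  fixes A :: "real^'n^'m"
  shows "infnorm (A *v u - A *v x) \<le> infnorm (A *v u - b) + infnorm (A *v x - b)"
  using infnorm_triangle[of "A *v u - b" "- (A *v x - b)"] unfolding infnorm_neg by simp

lemma small_residual_error_bound:
  fixes A :: "real^'n^'m"
  assumes rank: "rank A = CARD('n)"
    and small: "infnorm (A *v u - b) \<le> 4 * infnorm (A *v x - b)"
  shows "(norm (u - x))\<^sup>2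
    \<le> 25 * real CARD('m) * (1 / (sigma_min A)\<^sup>2) * (infnorm (A *v x - b))\<^sup>2"
proof -
  have \<sigma>: "(sigma_min A)\<^sup>2 > 0"
    using sigma_min_nonzero[OF rank] by simp
  \<comment> \<open>The 5 is 4 + 1, one part from each residual; its square is the 25 of the bound,
    and the dimension factor comes from \<open>norm_sq_le_infnorm_sq\<close>.\<close>
  have "infnorm (A *v u - A *v x) \<le> 5 * infnorm (A *v x - b)"
    using infnorm_mult_diff_le[of A u x b] small by linarith
  then have "(infnorm (A *v u - A *v x))\<^sup>2 \<le> (5 * infnorm (A *v x - b))\<^sup>2"
    by (intro power_mono infnorm_pos_le)
  then have "(norm (A *v u - A *v x))\<^sup>2 \<le> real CARD('m) * (5 * infnorm (A *v x - b))\<^sup>2"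
    by (meson norm_sq_le_infnorm_sq mult_left_mono of_nat_0_le_iff order_trans)
  with sigma_min_bound[of A "u - x"] \<sigma> show ?thesis
    by (simp add: matrix_vector_mult_diff_distrib field_simps power2_eq_square)
qed

text \<open>Besides the decrease itself, the sign of the factor is needed to chain the steps and to
  compare products factor by factor; the last part trades \<gamma> for its upper bound, the number
  of rows.\<close>

lemma motzkin_contraction:
  fixes A :: "real^'n^'m"
  assumes unit: "\<And>i. norm (row i A) = 1" and it: "motzkin_iterates A b X"
    and large: "infnorm (A *v X k - b) > 4 * infnorm (A *v x - b)"
    and \<gamma>: "\<gamma> = (norm (A *v X k - A *v x))\<^sup>2 / (infnorm (A *v X k - A *v x))\<^sup>2"
  shows "(norm (X (Suc k) - x))\<^sup>2 \<le> (1 - (sigma_min A)\<^sup>2 / (4 * \<gamma>)) * (norm (X k - x))\<^sup>2"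
    and "0 \<le> 1 - (sigma_min A)\<^sup>2 / (4 * \<gamma>)"
    and "1 - (sigma_min A)\<^sup>2 / (4 * \<gamma>) \<le> 1 - (sigma_min A)\<^sup>2 / (4 * real CARD('m))"
proof -
  define R E D N where "R = infnorm (A *v X k - b)" and "E = infnorm (A *v x - b)"
    and "D = infnorm (A *v X k - A *v x)" and "N = norm (X k - x)"
  define s where "s = (sigma_min A)\<^sup>2"
  have E: "E \<ge> 0" and RE: "R > 4 * E" and s: "s \<ge> 0"
    using large by (simp_all add: E_def R_def s_def infnorm_pos_le)
  have DRE: "D \<le> R + E"
    unfolding D_def R_def E_def by (rule infnorm_mult_diff_le)
  \<comment> \<open>With R > 4E this gives D > 3E \<ge> 0, so \<gamma> is a genuine quotient and not
    the default value of a division by zero.\<close>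
  have "R \<le> D + E"
    using infnorm_triangle[of "A *v X k - A *v x" "A *v x - b"]
    by (simp add: R_def D_def E_def)
  with RE E have D: "D > 0" by linarith
  have G: "(norm (A *v X k - A *v x))\<^sup>2 = \<gamma> * D\<^sup>2"
    using D by (simp add: \<gamma> D_def)
  have sN: "s * N\<^sup>2 \<le> \<gamma> * D\<^sup>2"
    using sigma_min_bound[of A "X k - x"] G
    by (simp add: s_def N_def matrix_vector_mult_diff_distrib)
  have "D\<^sup>2 \<le> \<gamma> * D\<^sup>2"
    unfolding G[symmetric] unfolding D_def by (intro power_mono infnorm_le_norm infnorm_pos_le)
  with D have \<gamma>1: "\<gamma> \<ge> 1" by simp
  have "\<gamma> * D\<^sup>2 \<le> real CARD('m) * D\<^sup>2"
    unfolding G[symmetric] unfolding D_def by (rule norm_sq_le_infnorm_sq)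
  with D have \<gamma>m: "\<gamma> \<le> real CARD('m)" by simp
  have DN: "D \<le> N"
    using infnorm_mult_le_norm[OF unit, of "X k - x"]
    by (simp add: D_def N_def matrix_vector_mult_diff_distrib)
  \<comment> \<open>Replacing D by the larger N in \<open>sN\<close> lets \<open>N\<^sup>2\<close>
    cancel and leaves s \<le> \<gamma>.\<close>
  have "\<gamma> * D\<^sup>2 \<le> \<gamma> * N\<^sup>2"
    using DN D \<gamma>1 by (intro mult_left_mono power_mono) auto
  with sN have "s * N\<^sup>2 \<le> \<gamma> * N\<^sup>2" by linarith
  with DN D have s\<gamma>: "s \<le> \<gamma>" by simp
  show "0 \<le> 1 - (sigma_min A)\<^sup>2 / (4 * \<gamma>)"
    using s\<gamma> \<gamma>1 by (simp add: s_def)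
  show "1 - (sigma_min A)\<^sup>2 / (4 * \<gamma>) \<le> 1 - (sigma_min A)\<^sup>2 / (4 * real CARD('m))"
    using \<gamma>1 \<gamma>m by (intro diff_left_mono divide_left_mono) auto
  have "2 * R * E \<le> R\<^sup>2 / 2"
    using mult_left_mono[of "4 * E" R R] RE E by (simp add: power2_eq_square)
  then have "(norm (X (Suc k) - x))\<^sup>2 \<le> N\<^sup>2 - R\<^sup>2 / 2"
    using motzkin_step[OF unit it, of k x] by (simp add: R_def E_def N_def)
  \<comment> \<open>E < R/4 gives D \<le> 5R/4, and 25/16 \<le> 2. The decrease
    \<open>R\<^sup>2 / 2\<close> thus dominates \<open>D\<^sup>2 / 4\<close>, which
    \<open>sN\<close> bounds below by a multiple of \<open>N\<^sup>2\<close>.\<close>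
  moreover have "D\<^sup>2 / 4 \<le> R\<^sup>2 / 2"
  proof -
    have "D\<^sup>2 \<le> (5 / 4 * R)\<^sup>2"
      using DRE RE D by (intro power_mono) auto
    also have "\<dots> = 25 / 16 * R\<^sup>2" by (simp add: power2_eq_square)
    also have "\<dots> \<le> 2 * R\<^sup>2" by simp
    finally show ?thesis by simp
  qed
  moreover have "s / (4 * \<gamma>) * N\<^sup>2 \<le> D\<^sup>2 / 4"
    using sN \<gamma>1 by (simp add: field_simps)
  ultimately have "(norm (X (Suc k) - x))\<^sup>2 \<le> N\<^sup>2 - s / (4 * \<gamma>) * N\<^sup>2"
    by linarith
  then show "(norm (X (Suc k) - x))\<^sup>2
      \<le> (1 - (sigma_min A)\<^sup>2 / (4 * \<gamma>)) * (norm (X k - x))\<^sup>2"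
    by (simp add: s_def N_def algebra_simps)
qed

section \<open>The alternative at each step, and the error at the stopping time\<close>

theorem corollary1:
  fixes A :: "real^'n^'m" and b e :: "real^'m" and x :: "real^'n"
    and X :: "nat \<Rightarrow> real^'n" and \<gamma> :: "nat \<Rightarrow> real"
  assumes full_rank: "rank A = CARD('n)"
    and unit_rows: "\<And>i. norm (row i A) = 1"
    and e: "e = A *v x - b"
    and iterates: "motzkin_iterates A b X"
    and gamma: "\<And>k. \<gamma> k = (norm (A *v X k - A *v x))\<^sup>2 / (infnorm (A *v X k - A *v x))\<^sup>2"
  shows
    "(\<forall>k. (norm (X (Suc k) - x))\<^sup>2 \<le> (norm (X k - x))\<^sup>2 - 1/2 * (infnorm (A *v X k - b))\<^sup>2
        \<or> ((norm (X k - x))\<^sup>2 \<le> 25 * real CARD('m) * (1 / (sigma_min A)\<^sup>2) * (infnorm e)\<^sup>2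
            \<and> (norm (X (Suc k) - x))\<^sup>2
                \<le> (25 * real CARD('m) * (1 / (sigma_min A)\<^sup>2) + 8) * (infnorm e)\<^sup>2))
     \<and> (\<forall>K. (\<forall>k<K. infnorm (A *v X k - b) > 4 * infnorm e)
            \<and> infnorm (A *v X K - b) \<le> 4 * infnorm e
          \<longrightarrow> (norm (X K - x))\<^sup>2
                \<le> (\<Prod>k<K. 1 - (sigma_min A)\<^sup>2 / (4 * \<gamma> k)) * (norm (X 0 - x))\<^sup>2
                    + 2 * real CARD('m) * (1 / (sigma_min A)\<^sup>2) * (infnorm e)\<^sup>2
            \<and> (\<Prod>k<K. 1 - (sigma_min A)\<^sup>2 / (4 * \<gamma> k)) * (norm (X 0 - x))\<^sup>2
                    + 2 * real CARD('m) * (1 / (sigma_min A)\<^sup>2) * (infnorm e)\<^sup>2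
                \<le> (1 - (sigma_min A)\<^sup>2 / (4 * real CARD('m))) ^ K * (norm (X 0 - x))\<^sup>2
                    + 2 * real CARD('m) * (1 / (sigma_min A)\<^sup>2) * (infnorm e)\<^sup>2
            \<and> (norm (X K - x))\<^sup>2 \<le> 25 * real CARD('m) * (1 / (sigma_min A)\<^sup>2) * (infnorm e)\<^sup>2)"
proof (intro conjI allI impI)
  fix k
  define R E where "R = infnorm (A *v X k - b)" and "E = infnorm e"
  have pos: "R \<ge> 0" "E \<ge> 0" by (simp_all add: R_def E_def infnorm_pos_le)
  have step: "(norm (X (Suc k) - x))\<^sup>2 \<le> (norm (X k - x))\<^sup>2 - R\<^sup>2 + 2 * R * E"
    using motzkin_step[OF unit_rows iterates, of k x] by (simp add: R_def E_def e)
  show "(norm (X (Suc k) - x))\<^sup>2 \<le> (norm (X k - x))\<^sup>2 - 1/2 * (infnorm (A *v X k - b))\<^sup>2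
      \<or> ((norm (X k - x))\<^sup>2 \<le> 25 * real CARD('m) * (1 / (sigma_min A)\<^sup>2) * (infnorm e)\<^sup>2
          \<and> (norm (X (Suc k) - x))\<^sup>2
              \<le> (25 * real CARD('m) * (1 / (sigma_min A)\<^sup>2) + 8) * (infnorm e)\<^sup>2)"
  proof (cases "4 * E \<le> R")
    case True
    then have "2 * R * E \<le> R\<^sup>2 / 2"
      using mult_left_mono[of "4 * E" R R] pos by (simp add: power2_eq_square)
    with step show ?thesis by (simp add: R_def)
  next
    case False
    then have ii: "(norm (X k - x))\<^sup>2
        \<le> 25 * real CARD('m) * (1 / (sigma_min A)\<^sup>2) * (infnorm e)\<^sup>2"
      using small_residual_error_bound[OF full_rank, of "X k" b x] by (simp add: R_def E_def e)
    \<comment> \<open>Completing the square bounds the possible growth in one step by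
      \<open>E\<^sup>2\<close>, well within the 8 of (iii).\<close>
    have "2 * R * E - R\<^sup>2 \<le> E\<^sup>2"
      using zero_le_power2[of "R - E"] by (simp add: power2_diff mult.commute)
    then have "(norm (X (Suc k) - x))\<^sup>2 \<le> (norm (X k - x))\<^sup>2 + 8 * E\<^sup>2"
      using step zero_le_power2[of E] by linarith
    with ii show ?thesis by (simp add: E_def distrib_right)
  qed
next
  fix K
  assume run: "(\<forall>k<K. infnorm (A *v X k - b) > 4 * infnorm e)
      \<and> infnorm (A *v X K - b) \<le> 4 * infnorm e"
  define c where "c k = 1 - (sigma_min A)\<^sup>2 / (4 * \<gamma> k)" for k
  have large: "infnorm (A *v X k - b) > 4 * infnorm (A *v x - b)" if "k < K" for k
    using run that by (simp add: e)
  note contr = motzkin_contraction[OF unit_rows iterates large gamma, folded c_def]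
  \<comment> \<open>The induction stays below \<open>K\<close> because a step is known to contract
    only before the stopping criterion is met.\<close>
  have "k \<le> K \<Longrightarrow> (norm (X k - x))\<^sup>2 \<le> (\<Prod>j<k. c j) * (norm (X 0 - x))\<^sup>2" for k
  proof (induction k)
    case (Suc k)
    then have "c k * (norm (X k - x))\<^sup>2 \<le> c k * ((\<Prod>j<k. c j) * (norm (X 0 - x))\<^sup>2)"
      by (intro mult_left_mono contr(2)) auto
    with contr(1)[of k] Suc.prems show ?case by (simp add: mult_ac)
  qed simp
  then have "(norm (X K - x))\<^sup>2 \<le> (\<Prod>k<K. c k) * (norm (X 0 - x))\<^sup>2" by simp
  \<comment> \<open>The additive term is nonnegative, so adding it preserves the product
    bound.\<close>
  moreover have "0 \<le> 2 * real CARD('m) * (1 / (sigma_min A)\<^sup>2) * (infnorm e)\<^sup>2" by simp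
  ultimately show "(norm (X K - x))\<^sup>2
      \<le> (\<Prod>k<K. 1 - (sigma_min A)\<^sup>2 / (4 * \<gamma> k)) * (norm (X 0 - x))\<^sup>2
        + 2 * real CARD('m) * (1 / (sigma_min A)\<^sup>2) * (infnorm e)\<^sup>2"
    unfolding c_def by linarith
  have "(\<Prod>k<K. c k) \<le> (\<Prod>k<K. 1 - (sigma_min A)\<^sup>2 / (4 * real CARD('m)))"
    using contr(2,3) by (intro prod_mono) auto
  then have "(\<Prod>k<K. c k) \<le> (1 - (sigma_min A)\<^sup>2 / (4 * real CARD('m))) ^ K" by simp
  then show "(\<Prod>k<K. 1 - (sigma_min A)\<^sup>2 / (4 * \<gamma> k)) * (norm (X 0 - x))\<^sup>2
        + 2 * real CARD('m) * (1 / (sigma_min A)\<^sup>2) * (infnorm e)\<^sup>2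
      \<le> (1 - (sigma_min A)\<^sup>2 / (4 * real CARD('m))) ^ K * (norm (X 0 - x))\<^sup>2
        + 2 * real CARD('m) * (1 / (sigma_min A)\<^sup>2) * (infnorm e)\<^sup>2"
    unfolding c_def by (intro add_right_mono mult_right_mono) auto
  \<comment> \<open>The stopping criterion is exactly the small-residual hypothesis at
    \<open>X K\<close>.\<close>
  show "(norm (X K - x))\<^sup>2 \<le> 25 * real CARD('m) * (1 / (sigma_min A)\<^sup>2) * (infnorm e)\<^sup>2"
    using small_residual_error_bound[OF full_rank, of "X K" b x] run by (simp add: e)
qed

end
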